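(* Let $n\geq 2$ be an odd integer. Then for every integer $k > (n-1)^2+2$, $$a^a_n(k) = 2a^a_n(k-1)-2a^a_n(k-3)+a^a_n(k-4).$$ Furthermore, for every integer $k > \max(7,(n-1)^2+2)$, $$a^o_n(k) = 2a^o_n(k-1)-2a^o_n(k-3)+a^o_n(k-4)$$ and $$a^r_n(k) = 2a^r_n(k-1)-2a^r_n(k-3)+a^r_n(k-4).$$
   Context: For integers $n\geq 1$ and $k\geq 0$, the $n$ by $k$ grid is the set of points $\{1,\dots,n\}\times\{1,\dots,k\}\subset\mathbb{R}^2$ (empty if $k=0$). Consider the 3-element non-collinear subsets of the grid that are the vertices of an isosceles triangle (at least two sides of equal Euclidean length). $a^a_n(k)$, $a^o_n(k)$ and $a^r_n(k)$ denote the numbers of such triangles that are, respectively, acute (all angles strictly less than $90^\circ$), obtuse (one angle strictly greater than $90^\circ$) and right (one angle equal to $90^\circ$). *)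

theory Defs
  imports "HOL-Analysis.Analysis"
begin

(* The plane is real * real; dist, norm and inner on this product type are Euclidean. *)

definition grid :: "nat \<Rightarrow> nat \<Rightarrow> (real \<times> real) set" where
  "grid n k = real ` {1..n} \<times> real ` {1..k}"

definition vertex_angle ::
    "real \<times> real \<Rightarrow> real \<times> real \<Rightarrow> real \<times> real \<Rightarrow> real" where
  "vertex_angle a b c =
     arccos (((a - b) \<bullet> (c - b)) / (norm (a - b) * norm (c - b)))"

(* A triangle is identified with its set of vertices. *)

definition is_triangle :: "(real \<times> real) set \<Rightarrow> bool" where
  "is_triangle T \<longleftrightarrow> card T = 3 \<and> \<not> collinear T"

definition isosceles :: "(real \<times> real) set \<Rightarrow> bool" where
  "isosceles T \<longleftrightarrow>
     (\<exists>a b c. T = {a, b, c} \<and> distinct [a, b, c] \<and> dist a b = dist a c)"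

definition angles :: "(real \<times> real) set \<Rightarrow> real set" where
  "angles T = {vertex_angle a b c | a b c. T = {a, b, c} \<and> distinct [a, b, c]}"

definition acute :: "(real \<times> real) set \<Rightarrow> bool" where
  "acute T \<longleftrightarrow> (\<forall>\<theta>\<in>angles T. \<theta> < pi / 2)"

definition obtuse :: "(real \<times> real) set \<Rightarrow> bool" where
  "obtuse T \<longleftrightarrow> (\<exists>\<theta>\<in>angles T. \<theta> > pi / 2)"

definition right_angled :: "(real \<times> real) set \<Rightarrow> bool" where
  "right_angled T \<longleftrightarrow> (\<exists>\<theta>\<in>angles T. \<theta> = pi / 2)"

definition isosceles_triangles :: "nat \<Rightarrow> nat \<Rightarrow> (real \<times> real) set set" where
  "isosceles_triangles n k = {T. T \<subseteq> grid n k \<and> is_triangle T \<and> isosceles T}"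

(* The counts are integer-valued so that subtraction in the recurrences is not truncated. *)

definition num_acute :: "nat \<Rightarrow> nat \<Rightarrow> int" where
  "num_acute n k = int (card {T \<in> isosceles_triangles n k. acute T})"

definition num_obtuse :: "nat \<Rightarrow> nat \<Rightarrow> int" where
  "num_obtuse n k = int (card {T \<in> isosceles_triangles n k. obtuse T})"

definition num_right :: "nat \<Rightarrow> nat \<Rightarrow> int" where
  "num_right n k = int (card {T \<in> isosceles_triangles n k. right_angled T})"

end

theory Submission
  imports Defs
begin

text \<open>
  The polynomial \<open>x^4 - 2 x^3 + 2 x - 1 = (x - 1)\<^sup>2 (x\<^sup>2 - 1)\<close> of the recurrence factors so that
  the claim says: the second difference in \<open>k\<close> of each count has period two. That second
  difference has a meaning. Sets in the grid that miss the first or the last column live, up to a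
  translation, in the grid with one column less, so by inclusion and exclusion the second difference
  at \<open>k\<close> is the number of triangles that meet both the first and the last of the \<open>k\<close> columns
  (\<open>card_grid_sets_second_difference\<close>).

  Such a spanning isosceles triangle has a rigid shape once the grid is long. Let \<open>w = k - 1\<close> be
  its length and \<open>m = n - 1\<close> the height of the grid, with \<open>w \<ge> m\<^sup>2\<close>. The two equal sides have
  horizontal extents \<open>x, x'\<close> and vertical extents \<open>a, b\<close> at most \<open>m\<close>, so the squares
  of \<open>x\<close> and \<open>x'\<close> differ by at most \<open>m\<^sup>2 \<le> w\<close>. If the apex lies in an end column,
  then one of the extents is \<open>w\<close>, and the next smaller square \<open>(w - 1)\<^sup>2\<close> is already too far
  away: the base lies in the opposite end column. If the apex lies strictly between, then
  \<open>x + x' = w\<close>, and \<open>x\<close> differing from \<open>x'\<close> would force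
  \<open>w = m\<^sup>2\<close> and \<open>\<bar>x - x'\<bar> = 1\<close>, hence \<open>w\<close> odd; but \<open>m\<close> is even because \<open>n\<close> is odd. So the
  apex lies in the middle column, and the base runs along a row through the whole length
  (\<open>spanning_isosceles_cases\<close>).

  Triangles of the first kind (fans) are acute. Those of the second kind (tents) exist only for odd
  \<open>k\<close>; they are never acute, and they are obtuse as soon as \<open>w > 2 m\<close>. This can fail
  for \<open>w \<ge> m\<^sup>2\<close> only when \<open>m = 2\<close> and \<open>w = 4\<close>, where a right-angled tent occurs; hence
  the extra bound 7 for the obtuse and right-angled counts. Both kinds are described by
  rows that do not involve \<open>k\<close>, so stretching the columns gives a bijection from those for
  \<open>k\<close> to those for \<open>k + 2\<close> (\<open>card_fans_periodic\<close>, \<open>card_tents_periodic\<close>), and no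
  right-angled spanning triangles are left.
\<close>

section \<open>Triangles and their angles through inner products\<close>

lemma collinear_cross_product:
  fixes a b c :: "real \<times> real"
  shows "collinear {a, b, c} \<longleftrightarrow>
    (fst a - fst b) * (snd c - snd b) = (snd a - snd b) * (fst c - fst b)"
proof -
  have key: "collinear {0, u, v} \<longleftrightarrow> fst u * snd v = snd u * fst v" for u v :: "real \<times> real"
  proof
    assume "collinear {0, u, v}"
    then show "fst u * snd v = snd u * fst v"
      by (auto simp: collinear_lemma)
  next
    assume eq: "fst u * snd v = snd u * fst v"
    show "collinear {0, u, v}"
    proof (cases "fst u = 0")
      case False
      then have "v = (fst v / fst u) *\<^sub>R u"
        using eq by (auto simp: prod_eq_iff field_simps)
      then show ?thesis by (auto simp: collinear_lemma)
    next
      case True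
      show ?thesis
      proof (cases "snd u = 0")
        case False
        then have "v = (snd v / snd u) *\<^sub>R u"
          using eq True by (auto simp: prod_eq_iff field_simps)
        then show ?thesis by (auto simp: collinear_lemma)
      next
        case False': True
        with True have "u = 0" by (simp add: prod_eq_iff)
        then show ?thesis by (auto simp: collinear_lemma)
      qed
    qed
  qed
  show ?thesis
    by (subst collinear_3) (simp_all add: key)
qed

lemma vertex_angle_commute: "vertex_angle a b c = vertex_angle c b a"
  by (simp add: vertex_angle_def inner_commute mult.commute)

text \<open>
  The cosine of an angle has the sign of the inner product, and \<open>arccos\<close> is strictly decreasing
  with value \<open>pi / 2\<close> at 0.
\<close>

lemma
  assumes "a \<noteq> b" "c \<noteq> b"
  shows vertex_angle_less_right_iff: "vertex_angle a b c < pi / 2 \<longleftrightarrow> (a - b) \<bullet> (c - b) > 0"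
    and vertex_angle_greater_right_iff: "vertex_angle a b c > pi / 2 \<longleftrightarrow> (a - b) \<bullet> (c - b) < 0"
    and vertex_angle_eq_right_iff: "vertex_angle a b c = pi / 2 \<longleftrightarrow> (a - b) \<bullet> (c - b) = 0"
proof -
  let ?p = "norm (a - b) * norm (c - b)"
  let ?x = "((a - b) \<bullet> (c - b)) / ?p"
  have p: "?p > 0" using assms by simp
  have "\<bar>(a - b) \<bullet> (c - b)\<bar> \<le> ?p" by (rule Cauchy_Schwarz_ineq2)
  then have x: "\<bar>?x\<bar> \<le> 1" using p by (simp add: abs_mult field_simps)
  have lt: "arccos ?x < arccos 0 \<longleftrightarrow> 0 < ?x" "arccos 0 < arccos ?x \<longleftrightarrow> ?x < 0"
    by (rule arccos_less_mono[OF x], simp) (rule arccos_less_mono[OF _ x], simp)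
  have sgn: "0 < ?x \<longleftrightarrow> (a - b) \<bullet> (c - b) > 0" "?x < 0 \<longleftrightarrow> (a - b) \<bullet> (c - b) < 0"
    using p by (simp_all only: zero_less_divide_iff divide_less_0_iff) auto
  show less: "vertex_angle a b c < pi / 2 \<longleftrightarrow> (a - b) \<bullet> (c - b) > 0"
    and greater: "vertex_angle a b c > pi / 2 \<longleftrightarrow> (a - b) \<bullet> (c - b) < 0"
    unfolding vertex_angle_def using lt sgn by simp_all
  then show "vertex_angle a b c = pi / 2 \<longleftrightarrow> (a - b) \<bullet> (c - b) = 0"
    by linarith
qed

text \<open>
  The set of angles ranges over all six orderings of the vertices; exchanging the outer
  two points does not change the angle, which leaves one angle for each vertex.
\<close>

lemma angles_three_points:
  assumes "distinct [a, b, c]"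
  shows "angles {a, b, c} = {vertex_angle b a c, vertex_angle a b c, vertex_angle a c b}"
proof
  show "angles {a, b, c} \<subseteq> {vertex_angle b a c, vertex_angle a b c, vertex_angle a c b}"
  proof
    fix t assume "t \<in> angles {a, b, c}"
    then obtain x y z where t: "t = vertex_angle x y z" and T: "{a, b, c} = {x, y, z}"
      and d: "distinct [x, y, z]"
      unfolding angles_def by auto
    have "x \<in> {a, b, c}" "y \<in> {a, b, c}" "z \<in> {a, b, c}" using T by auto
    then show "t \<in> {vertex_angle b a c, vertex_angle a b c, vertex_angle a c b}"
      using d t by (auto simp: vertex_angle_commute)
  qed
  have "vertex_angle x y z \<in> angles {a, b, c}"
    if "{a, b, c} = {x, y, z}" "distinct [x, y, z]" for x y z
    using that unfolding angles_def by blast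
  from this[of b a c] this[of a b c] this[of a c b] assms
  show "{vertex_angle b a c, vertex_angle a b c, vertex_angle a c b} \<subseteq> angles {a, b, c}"
    by (auto simp: insert_commute)
qed

lemma
  assumes "distinct [a, b, c]"
  shows acute_three_points_iff: "acute {a, b, c} \<longleftrightarrow>
      (b - a) \<bullet> (c - a) > 0 \<and> (a - b) \<bullet> (c - b) > 0 \<and> (a - c) \<bullet> (b - c) > 0"
    and obtuse_three_points_iff: "obtuse {a, b, c} \<longleftrightarrow>
      (b - a) \<bullet> (c - a) < 0 \<or> (a - b) \<bullet> (c - b) < 0 \<or> (a - c) \<bullet> (b - c) < 0"
    and right_angled_three_points_iff: "right_angled {a, b, c} \<longleftrightarrow>
      (b - a) \<bullet> (c - a) = 0 \<or> (a - b) \<bullet> (c - b) = 0 \<or> (a - c) \<bullet> (b - c) = 0"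
proof -
  have "a \<noteq> b" "a \<noteq> c" "b \<noteq> c" using assms by auto
  note ne = this this[symmetric]
  show "acute {a, b, c} \<longleftrightarrow>
      (b - a) \<bullet> (c - a) > 0 \<and> (a - b) \<bullet> (c - b) > 0 \<and> (a - c) \<bullet> (b - c) > 0"
    unfolding acute_def angles_three_points[OF assms]
    using ne vertex_angle_less_right_iff[of b a c] vertex_angle_less_right_iff[of a b c]
      vertex_angle_less_right_iff[of a c b] by auto
  show "obtuse {a, b, c} \<longleftrightarrow>
      (b - a) \<bullet> (c - a) < 0 \<or> (a - b) \<bullet> (c - b) < 0 \<or> (a - c) \<bullet> (b - c) < 0"
    unfolding obtuse_def angles_three_points[OF assms]
    using ne vertex_angle_greater_right_iff[of b a c] vertex_angle_greater_right_iff[of a b c]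
      vertex_angle_greater_right_iff[of a c b] by auto
  show "right_angled {a, b, c} \<longleftrightarrow>
      (b - a) \<bullet> (c - a) = 0 \<or> (a - b) \<bullet> (c - b) = 0 \<or> (a - c) \<bullet> (b - c) = 0"
    unfolding right_angled_def angles_three_points[OF assms]
    using ne vertex_angle_eq_right_iff[of b a c] vertex_angle_eq_right_iff[of a b c]
      vertex_angle_eq_right_iff[of a c b] by auto
qed

lemma acute_not_obtuse_right: "acute T \<Longrightarrow> \<not> obtuse T \<and> \<not> right_angled T"
  unfolding acute_def obtuse_def right_angled_def by fastforce

section \<open>Translation invariance\<close>

text \<open>
  One direction only; translating back by \<open>- v\<close> then gives the converse of each.
\<close>

lemma translate_preserves:
  fixes v :: "real \<times> real"
  shows "is_triangle T \<Longrightarrow> is_triangle ((+) v ` T)"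
    and "isosceles T \<Longrightarrow> isosceles ((+) v ` T)"
    and "angles T \<subseteq> angles ((+) v ` T)"
proof -
  show "is_triangle ((+) v ` T)" if T: "is_triangle T"
  proof -
    have c: "card T = 3" using T by (simp add: is_triangle_def)
    then obtain a b c where abc: "T = {a, b, c}" by (auto simp: card_3_iff)
    have "card ((+) v ` T) = 3" using c by (simp add: card_image)
    moreover have "\<not> collinear ((+) v ` T)"
      using T unfolding is_triangle_def abc by (simp add: collinear_cross_product)
    ultimately show ?thesis by (simp add: is_triangle_def)
  qed
  show "isosceles ((+) v ` T)" if iso: "isosceles T"
  proof -
    obtain a b c where "T = {a, b, c}" "distinct [a, b, c]" "dist a b = dist a c"
      using iso unfolding isosceles_def by blast
    then have "(+) v ` T = {v + a, v + b, v + c}" "distinct [v + a, v + b, v + c]"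
      "dist (v + a) (v + b) = dist (v + a) (v + c)" by auto
    then show ?thesis unfolding isosceles_def by blast
  qed
  show "angles T \<subseteq> angles ((+) v ` T)"
  proof
    fix t assume "t \<in> angles T"
    then obtain a b c where T: "T = {a, b, c}" and d: "distinct [a, b, c]"
      and t: "t = vertex_angle a b c"
      unfolding angles_def by blast
    have "t = vertex_angle (v + a) (v + b) (v + c)" by (simp add: t vertex_angle_def)
    moreover have "(+) v ` T = {v + a, v + b, v + c}" "distinct [v + a, v + b, v + c]"
      using T d by auto
    ultimately show "t \<in> angles ((+) v ` T)" unfolding angles_def by blast
  qed
qed

lemma translate_iff:
  fixes v :: "real \<times> real"
  shows is_triangle_translate: "is_triangle ((+) v ` T) \<longleftrightarrow> is_triangle T"
    and isosceles_translate: "isosceles ((+) v ` T) \<longleftrightarrow> isosceles T"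
    and angles_translate: "angles ((+) v ` T) = angles T"
proof -
  have undo: "(+) (- v) ` (+) v ` T = T" by (simp add: image_image)
  show "is_triangle ((+) v ` T) \<longleftrightarrow> is_triangle T"
    using translate_preserves(1)[of T v] translate_preserves(1)[of "(+) v ` T" "- v"]
    unfolding undo by blast
  show "isosceles ((+) v ` T) \<longleftrightarrow> isosceles T"
    using translate_preserves(2)[of T v] translate_preserves(2)[of "(+) v ` T" "- v"]
    unfolding undo by blast
  show "angles ((+) v ` T) = angles T"
    using translate_preserves(3)[of T v] translate_preserves(3)[of "(+) v ` T" "- v"]
    unfolding undo by blast
qed

section \<open>The second difference counts spanning sets\<close>

definition grid_sets :: "((real \<times> real) set \<Rightarrow> bool) \<Rightarrow> nat \<Rightarrow> nat \<Rightarrow> (real \<times> real) set set" where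
  "grid_sets Q n k = {T. T \<subseteq> grid n k \<and> Q T}"

definition spanning_sets :: "((real \<times> real) set \<Rightarrow> bool) \<Rightarrow> nat \<Rightarrow> nat \<Rightarrow> (real \<times> real) set set" where
  "spanning_sets Q n k = {T \<in> grid_sets Q n k. 1 \<in> snd ` T \<and> real k \<in> snd ` T}"

lemma finite_grid_sets: "finite (grid_sets Q n k)"
proof (rule finite_subset)
  show "grid_sets Q n k \<subseteq> Pow (grid n k)" by (auto simp: grid_sets_def)
  show "finite (Pow (grid n k))" by (simp add: grid_def)
qed

text \<open>
  The grid with one column less occurs in two ways inside a given grid: directly, and
  translated by one column. The two copies miss the last and the first column, respectively.
\<close>

lemma grid_without_last_column: "grid n k = {p \<in> grid n (Suc k). snd p \<noteq> real (Suc k)}"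
proof -
  have "real ` {1..k} = {t \<in> real ` {1..Suc k}. t \<noteq> real (Suc k)}"
    by (auto simp: le_Suc_eq)
  then show ?thesis unfolding grid_def by auto
qed

lemma grid_without_first_column:
  "(+) (0, 1) ` grid n k = {p \<in> grid n (Suc k). snd p \<noteq> 1}"
proof (intro subset_antisym subsetI)
  fix p assume "p \<in> (+) (0, 1) ` grid n k"
  then obtain i j where "i \<in> {1..n}" "j \<in> {1..k}" and p: "p = (real i, real (Suc j))"
    unfolding grid_def by auto
  then have "i \<in> {1..n}" "Suc j \<in> {1..Suc k}" "real (Suc j) \<noteq> 1" by auto
  then show "p \<in> {p \<in> grid n (Suc k). snd p \<noteq> 1}"
    unfolding grid_def p by (auto simp del: of_nat_Suc)
next
  fix p assume "p \<in> {p \<in> grid n (Suc k). snd p \<noteq> 1}"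
  then obtain i j where ij: "i \<in> {1..n}" "j \<in> {1..Suc k}" "p = (real i, real j)" "j \<noteq> 1"
    unfolding grid_def by auto
  then have "j - 1 \<in> {1..k}" "p = (0, 1) + (real i, real (j - 1))" by auto
  then show "p \<in> (+) (0, 1) ` grid n k"
    unfolding grid_def using ij(1) by blast
qed

text \<open>
  Sets missing the last column form \<open>A\<close>, sets missing the first column form a translated copy
  \<open>B\<close> of the same family, and \<open>A \<inter> B\<close> is a translated copy of the family for two columns less.
  What is in neither of them is spanning, so the formula is inclusion and exclusion for
  \<open>A \<union> B\<close>.
\<close>

lemma card_grid_sets_second_difference:
  assumes inv: "\<And>T. Q ((+) (0, 1) ` T) \<longleftrightarrow> Q T"
  shows "int (card (grid_sets Q n (Suc (Suc j)))) =
    2 * int (card (grid_sets Q n (Suc j))) - int (card (grid_sets Q n j))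
    + int (card (spanning_sets Q n (Suc (Suc j))))"
proof -
  let ?\<tau> = "(+) (0::real, 1::real)"
  let ?k = "Suc (Suc j)"
  let ?A = "grid_sets Q n (Suc j)" and ?B = "image ?\<tau> ` grid_sets Q n (Suc j)"
  let ?S = "spanning_sets Q n ?k"
  have shifted: "image ?\<tau> ` grid_sets Q n l = {T. T \<subseteq> ?\<tau> ` grid n l \<and> Q T}" for l
    unfolding grid_sets_def using inv by (auto simp: subset_image_iff)
  have A: "?A = {T \<in> grid_sets Q n ?k. real ?k \<notin> snd ` T}"
    unfolding grid_sets_def by (subst grid_without_last_column) force
  have B: "?B = {T \<in> grid_sets Q n ?k. 1 \<notin> snd ` T}"
    unfolding shifted grid_without_first_column unfolding grid_sets_def by force
  have inner: "?\<tau> ` grid n j = {p \<in> grid n ?k. snd p \<noteq> 1 \<and> snd p \<noteq> real ?k}"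
    unfolding grid_without_first_column
    by (subst grid_without_last_column[of n "Suc j"]) auto
  have "?A \<inter> ?B = {T \<in> grid_sets Q n ?k. 1 \<notin> snd ` T \<and> real ?k \<notin> snd ` T}"
    unfolding B unfolding A by blast
  also have "\<dots> = image ?\<tau> ` grid_sets Q n j"
    unfolding shifted inner unfolding grid_sets_def by (auto simp: image_iff subset_iff; blast)
  finally have AB: "?A \<inter> ?B = image ?\<tau> ` grid_sets Q n j" .
  have inj: "inj_on (image ?\<tau>) X" for X
    by (rule inj_onI) (simp add: inj_image_eq_iff)
  have fin: "finite ?A" "finite ?B" "finite ?S"
    using finite_grid_sets unfolding spanning_sets_def by auto
  have "grid_sets Q n ?k = (?A \<union> ?B) \<union> ?S"
    unfolding B unfolding A spanning_sets_def by auto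
  moreover have "(?A \<union> ?B) \<inter> ?S = {}"
    unfolding B unfolding A spanning_sets_def by auto
  ultimately have "card (grid_sets Q n ?k) = card (?A \<union> ?B) + card ?S"
    using fin by (simp add: card_Un_disjoint)
  moreover have "card ?A + card ?B = card (?A \<union> ?B) + card (?A \<inter> ?B)"
    using fin by (intro card_Un_Int)
  moreover have "card ?B = card ?A" "card (?A \<inter> ?B) = card (grid_sets Q n j)"
    unfolding AB by (simp_all add: card_image inj)
  ultimately show ?thesis by linarith
qed

text \<open>
  Subtract the second-difference formulas at \<open>k\<close> and at \<open>k - 2\<close>: the spanning sets cancel, and so
  do the terms for \<open>k - 2\<close> columns.
\<close>

lemma card_grid_sets_recurrence:
  assumes inv: "\<And>T. Q ((+) (0, 1) ` T) \<longleftrightarrow> Q T" and k: "k \<ge> 4"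
    and periodic: "card (spanning_sets Q n k) = card (spanning_sets Q n (k - 2))"
  shows "int (card (grid_sets Q n k)) =
    2 * int (card (grid_sets Q n (k - 1))) - 2 * int (card (grid_sets Q n (k - 3)))
    + int (card (grid_sets Q n (k - 4)))"
proof -
  define j where "j = k - 4"
  have j: "k = Suc (Suc (Suc (Suc j)))" using k by (simp add: j_def)
  have e: "k - 1 = Suc (Suc (Suc j))" "k - 2 = Suc (Suc j)" "k - 3 = Suc j" "k - 4 = j"
    using j by auto
  show ?thesis
    using card_grid_sets_second_difference[of Q n "Suc (Suc j)", OF inv]
      card_grid_sets_second_difference[of Q n j, OF inv] periodic
    unfolding e unfolding j by linarith
qed

section \<open>Fans and tents\<close>

text \<open>
  Apex in row \<open>y\<close> of column \<open>s\<close>, base of length \<open>2 d\<close> in column \<open>t\<close>, opposite to the apex. Rows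
  and columns are real numbers so that the base needs no truncated subtraction and
  columns can be rescaled.
\<close>

definition fan :: "real \<Rightarrow> real \<Rightarrow> real \<times> real \<Rightarrow> (real \<times> real) set" where
  "fan s t = (\<lambda>(y, d). {(y, s), (y - d, t), (y + d, t)})"

definition fans :: "nat \<Rightarrow> nat \<Rightarrow> (real \<times> real) set set" where
  "fans n k = (let I = {(y, d). d > 0 \<and> {y - d, y, y + d} \<subseteq> real ` {1..n}}
     in fan 1 (real k) ` I \<union> fan (real k) 1 ` I)"

text \<open>
  Base along row \<open>y\<close> from the first column to the last, apex above or below its midpoint in row
  \<open>z\<close>. The midpoint is a grid column only for odd \<open>k\<close>.
\<close>

definition tent :: "nat \<Rightarrow> real \<times> real \<Rightarrow> (real \<times> real) set" where
  "tent k = (\<lambda>(y, z). {(z, (real k + 1) / 2), (y, 1), (y, real k)})"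

definition tents :: "nat \<Rightarrow> nat \<Rightarrow> (real \<times> real) set set" where
  "tents n k = (if odd k then tent k ` {(y, z). y \<noteq> z \<and> {y, z} \<subseteq> real ` {1..n}} else {})"

text \<open>
  Consecutive squares near \<open>w\<^sup>2\<close> are \<open>2 w - 1 > m\<^sup>2\<close> apart, more than vertical extents up
  to \<open>m\<close> can make up for. So two equal sides from an apex in an end column both reach the
  opposite column if one of them does.
\<close>

lemma column_of_long_side:
  fixes w x a b m :: int
  assumes "0 \<le> x" "x \<le> w" "\<bar>b\<bar> \<le> m" "m\<^sup>2 \<le> w" "w \<ge> 2"
    and eq: "w\<^sup>2 + a\<^sup>2 = x\<^sup>2 + b\<^sup>2"
  shows "x = w"
proof (rule ccontr)
  assume "x \<noteq> w"
  then have "x \<le> w - 1" using assms by simp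
  then have "x\<^sup>2 \<le> (w - 1)\<^sup>2" using assms by (intro power_mono) auto
  moreover have "b\<^sup>2 \<le> m\<^sup>2" using assms by (simp add: abs_le_square_iff[symmetric])
  moreover have "(w - 1)\<^sup>2 = w\<^sup>2 - 2 * w + 1" by (simp add: power2_eq_square algebra_simps)
  moreover have "a\<^sup>2 \<ge> 0" by simp
  ultimately show False using assms by linarith
qed

text \<open>
  The equation reads \<open>w (2 x - w) = b\<^sup>2 - a\<^sup>2\<close>, whose right side is at most \<open>m\<^sup>2 \<le> w\<close>
  in absolute value. A nonzero factor \<open>2 x - w\<close> could therefore only be \<open>1\<close> or \<open>-1\<close>, with
  \<open>w = m\<^sup>2\<close>. Parity of \<open>m\<close> excludes this case; it is here that the number of rows has to be odd.
\<close>

lemma column_of_middle_apex: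
  fixes w x a b m :: int
  assumes "\<bar>a\<bar> \<le> m" "\<bar>b\<bar> \<le> m" "m\<^sup>2 \<le> w" "even m"  "w > 0"
    and eq: "x\<^sup>2 + a\<^sup>2 = (w - x)\<^sup>2 + b\<^sup>2"
  shows "2 * x = w"
proof (rule ccontr)
  assume ne: "2 * x \<noteq> w"
  have prod: "w * (2 * x - w) = b\<^sup>2 - a\<^sup>2"
    using eq by (simp add: power2_eq_square algebra_simps)
  have "b\<^sup>2 \<le> m\<^sup>2" "a\<^sup>2 \<le> m\<^sup>2" using assms by (simp_all add: abs_le_square_iff[symmetric])
  then have "\<bar>b\<^sup>2 - a\<^sup>2\<bar> \<le> m\<^sup>2"
    using zero_le_power2[of a] zero_le_power2[of b] by linarith
  moreover have "w * \<bar>2 * x - w\<bar> = \<bar>b\<^sup>2 - a\<^sup>2\<bar>"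
    unfolding prod[symmetric] abs_mult using \<open>w > 0\<close> by simp
  ultimately have up: "w * \<bar>2 * x - w\<bar> \<le> m\<^sup>2" by simp
  have "w * 1 \<le> w * \<bar>2 * x - w\<bar>" using ne \<open>w > 0\<close> by (intro mult_left_mono) auto
  then have w: "w = m\<^sup>2" and "w * \<bar>2 * x - w\<bar> = w * 1" using up assms by linarith+
  then have "\<bar>2 * x - w\<bar> = 1" using \<open>w > 0\<close> by simp
  moreover have "even w" using w \<open>even m\<close> by simp
  ultimately show False by presburger
qed

text \<open>
  The base angles of an isosceles triangle are acute, and the apex angle of a fan is acute because
  half the base, which fits into the \<open>n\<close> rows, is shorter than the altitude \<open>k - 1\<close>.
\<close>

lemma fans_acute:
  assumes k: "k > n" and T: "T \<in> fans n k"
  shows "T \<in> spanning_sets (\<lambda>T. is_triangle T \<and> isosceles T \<and> acute T) n k"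
proof -
  obtain p s t where Tp: "T = fan s t p"
    and p: "p \<in> {(y, d). d > 0 \<and> {y - d, y, y + d} \<subseteq> real ` {1..n}}"
    and st: "(s = 1 \<and> t = real k) \<or> (s = real k \<and> t = 1)"
    using T unfolding fans_def Let_def by blast
  obtain y d where yd: "p = (y, d)" by (cases p)
  have T: "T = {(y, s), (y - d, t), (y + d, t)}" unfolding Tp yd fan_def by simp
  have d: "d > 0" and rows: "{y - d, y, y + d} \<subseteq> real ` {1..n}"
    using p unfolding yd by blast+
  let ?a = "(y, s)" and ?b = "(y - d, t)" and ?c = "(y + d, t)"
  have "y - d \<ge> 1" "y + d \<le> real n" using rows by auto
  then have "d < real k - 1" using k by linarith
  then have "d < \<bar>t - s\<bar>" using st d by auto
  then have sq: "d\<^sup>2 < (t - s)\<^sup>2" using d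
    by (metis abs_of_pos power2_abs power_strict_mono zero_less_numeral less_imp_le)
  have dist: "distinct [?a, ?b, ?c]" using d by auto
  have "s \<noteq> t" using sq d by auto
  have "\<not> collinear {?a, ?b, ?c}"
    using \<open>s \<noteq> t\<close> d by (auto simp: collinear_cross_product)
  then have "is_triangle T" using dist T by (auto simp: is_triangle_def)
  moreover have "dist ?a ?b = dist ?a ?c" by (simp add: dist_Pair_Pair dist_real_def)
  then have "isosceles T" using dist unfolding isosceles_def T by blast
  moreover have "acute T"
    unfolding T acute_three_points_iff[OF dist]
    using sq d by (auto simp: inner_prod_def power2_eq_square algebra_simps add_pos_pos)
  moreover have "T \<subseteq> grid n k" 
    using rows st k unfolding T grid_def by force
  moreover have "1 \<in> snd ` T \<and> real k \<in> snd ` T" using st T by auto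
  ultimately show ?thesis unfolding spanning_sets_def grid_sets_def by blast
qed

text \<open>
  With half base \<open>h = (k - 1) / 2\<close> and altitude \<open>\<bar>y - z\<bar> \<le> n - 1\<close>, the inner product at the apex
  is \<open>(y - z)\<^sup>2 - h\<^sup>2\<close>, while at the two other vertices it is \<open>2 h\<^sup>2 > 0\<close>.
\<close>

lemma
  assumes k: "k > 1" and T: "T \<in> tents n k"
  shows tents_spanning: "T \<in> spanning_sets (\<lambda>T. is_triangle T \<and> isosceles T) n k"
    and tents_not_acute: "k - 1 \<ge> 2 * (n - 1) \<Longrightarrow> \<not> acute T"
    and tents_obtuse: "k - 1 > 2 * (n - 1) \<Longrightarrow> obtuse T \<and> \<not> right_angled T"
proof -
  have "odd k" using T by (auto simp: tents_def split: if_splits)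
  obtain y z where T: "T = {(z, (real k + 1) / 2), (y, 1), (y, real k)}" and yz: "y \<noteq> z"
    and rows: "{y, z} \<subseteq> real ` {1..n}"
    using T unfolding tents_def tent_def by (auto split: if_splits)
  let ?a = "(z, (real k + 1) / 2)" and ?b = "(y, 1::real)" and ?c = "(y, real k)"
  let ?h = "(real k - 1) / 2"
  have h: "?h > 0" using k by simp
  have dist: "distinct [?a, ?b, ?c]" using yz k by auto
  have "\<not> collinear {?a, ?b, ?c}"
    using yz k by (auto simp: collinear_cross_product)
  then have "is_triangle T" using dist T by (auto simp: is_triangle_def)
  moreover have "dist ?a ?b = dist ?a ?c"
    by (simp add: dist_Pair_Pair dist_real_def power2_eq_square field_simps)
  then have "isosceles T" using dist unfolding isosceles_def T by blast
  moreover have "T \<subseteq> grid n k"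
  proof -
    obtain q where q: "k = 2 * q + 1" using \<open>odd k\<close> by (elim oddE)
    then have "(real k + 1) / 2 = real (q + 1)" "q + 1 \<in> {1..k}" by auto
    then have "(real k + 1) / 2 \<in> real ` {1..k}" by blast
    then show ?thesis using rows k unfolding T grid_def by force
  qed
  moreover have "1 \<in> snd ` T \<and> real k \<in> snd ` T" unfolding T by auto
  ultimately show "T \<in> spanning_sets (\<lambda>T. is_triangle T \<and> isosceles T) n k"
    unfolding spanning_sets_def grid_sets_def by blast
  have inner: "(?b - ?a) \<bullet> (?c - ?a) = (y - z)\<^sup>2 - ?h\<^sup>2"
    by (simp add: inner_prod_def power2_eq_square field_simps)
  have "(?a - ?b) \<bullet> (?c - ?b) = 2 * ?h\<^sup>2" "(?a - ?c) \<bullet> (?b - ?c) = 2 * ?h\<^sup>2"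
    by (simp_all add: inner_prod_def power2_eq_square field_simps)
  moreover have "2 * ?h\<^sup>2 > 0" using h by simp
  ultimately have base: "(?a - ?b) \<bullet> (?c - ?b) > 0" "(?a - ?c) \<bullet> (?b - ?c) > 0"
    by linarith+
  have n: "n \<ge> 1" using rows by auto
  have yzn: "\<bar>y - z\<bar> \<le> real (n - 1)" using rows by auto
  show "\<not> acute T" if "k - 1 \<ge> 2 * (n - 1)"
  proof -
    have "real (n - 1) \<le> ?h" using that k n by (simp add: of_nat_diff field_simps) 
    then have "\<bar>y - z\<bar>\<^sup>2 \<le> ?h\<^sup>2" using yzn by (intro power_mono) auto
    then show ?thesis unfolding T acute_three_points_iff[OF dist] inner by simp
  qed
  show "obtuse T \<and> \<not> right_angled T" if "k - 1 > 2 * (n - 1)"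
  proof -
    have "real (n - 1) < ?h" using that k n by (simp add: of_nat_diff field_simps) 
    then have "\<bar>y - z\<bar>\<^sup>2 < ?h\<^sup>2" using yzn by (intro power_strict_mono) auto
    then have "(?b - ?a) \<bullet> (?c - ?a) < 0" unfolding inner by simp
    then show ?thesis
      unfolding T obtuse_three_points_iff[OF dist] right_angled_three_points_iff[OF dist]
      using base by linarith
  qed
qed

text \<open>
  In coordinates relative to the apex \<open>a\<close>, the previous two arithmetic lemmas determine
  the columns of \<open>b\<close> and \<open>c\<close>. Equal horizontal extents then leave equal vertical extents, that
  is, \<open>b\<close> and \<open>c\<close> lie in the same row or in rows symmetric about that of \<open>a\<close>.
  For an apex in an end column the first option makes \<open>b\<close> and \<open>c\<close> coincide; for one in
  the middle column the second makes the three points collinear.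
\<close>

lemma spanning_isosceles_cases:
  assumes n: "odd n" "n \<ge> 2" and k: "k - 1 \<ge> (n - 1)\<^sup>2"
    and T: "T \<in> spanning_sets (\<lambda>T. is_triangle T \<and> isosceles T) n k"
  shows "T \<in> fans n k \<union> tents n k"
proof -
  have sub: "T \<subseteq> grid n k" and tri: "is_triangle T" and iso: "isosceles T"
    and ends: "1 \<in> snd ` T" "real k \<in> snd ` T"
    using T unfolding spanning_sets_def grid_sets_def by auto
  define m w where "m = int n - 1" and "w = int k - 1"
  have "n \<ge> 3" using n by presburger
  then have "m \<ge> 2" by (simp add: m_def)
  have "(int (n - 1))\<^sup>2 \<le> int (k - 1)" using k by (metis of_nat_le_iff of_nat_power)
  then have mw: "m\<^sup>2 \<le> w" using n k by (cases "k = 0") (auto simp: m_def w_def of_nat_diff)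
  have "2\<^sup>2 \<le> m\<^sup>2" using \<open>m \<ge> 2\<close> by (intro power_mono) auto
  then have w2: "w \<ge> 2" using mw by simp
  have "even m" using n by (simp add: m_def)
  have col: "1 \<le> q \<and> q \<le> int k" "1 \<le> p \<and> p \<le> int n"
    if "(of_int p, of_int q) \<in> T" for p q :: int
  proof -
    have "(of_int p, of_int q) \<in> grid n k" using sub that by blast
    then obtain i j where "i \<in> {1..n}" "j \<in> {1..k}" "real_of_int p = real i"
      "real_of_int q = real j"
      unfolding grid_def by auto
    moreover from this have "p = int i" "q = int j" by linarith+
    ultimately show "1 \<le> q \<and> q \<le> int k" "1 \<le> p \<and> p \<le> int n" by simp_all
  qed
  obtain a b c where abc: "T = {a, b, c}" "distinct [a, b, c]" "dist a b = dist a c"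
    using iso unfolding isosceles_def by blast
  have "\<exists>p q. u = (real_of_int p, real_of_int q)" if "u \<in> T" for u
  proof -
    obtain i j where "u = (real i, real j)" using sub \<open>u \<in> T\<close> unfolding grid_def by auto
    then have "u = (real_of_int (int i), real_of_int (int j))" by simp
    then show ?thesis by blast
  qed
  then obtain a1 a2 b1 b2 c1 c2 :: int
    where a: "a = (of_int a1, of_int a2)" and b: "b = (of_int b1, of_int b2)"
      and c: "c = (of_int c1, of_int c2)"
    using abc(1) by (metis insertCI)
  have range: "1 \<le> a1" "a1 \<le> int n" "1 \<le> b1" "b1 \<le> int n" "1 \<le> c1" "c1 \<le> int n"
    "1 \<le> a2" "a2 \<le> int k" "1 \<le> b2" "b2 \<le> int k" "1 \<le> c2" "c2 \<le> int k"
    using col[of a1 a2] col[of b1 b2] col[of c1 c2] abc(1) a b c by auto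
  have row_bound: "\<bar>a1 - b1\<bar> \<le> m" "\<bar>a1 - c1\<bar> \<le> m"
    using range by (auto simp: m_def)
  have in_rows: "of_int p \<in> real ` {1..n}" if "1 \<le> p" "p \<le> int n" for p
    using that by (intro image_eqI[of _ _ "nat p"]) auto
  have "of_int ((a1 - b1)\<^sup>2 + (a2 - b2)\<^sup>2) = (of_int ((a1 - c1)\<^sup>2 + (a2 - c2)\<^sup>2) :: real)"
    using abc(3) unfolding a b c by (simp add: dist_Pair_Pair dist_real_def)
  then have eq: "(a1 - b1)\<^sup>2 + (a2 - b2)\<^sup>2 = (a1 - c1)\<^sup>2 + (a2 - c2)\<^sup>2"
    by (simp only: of_int_eq_iff)
  have ends': "1 \<in> {a2, b2, c2}" "int k \<in> {a2, b2, c2}"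
    using ends unfolding abc(1) a b c by auto
  have ncol: "\<not> collinear {a, b, c}" using tri abc(1) by (simp add: is_triangle_def)
  have fan_case: "T \<in> fans n k"
    if opp: "b2 = t" "c2 = t" and st: "(a2 = 1 \<and> t = int k) \<or> (a2 = int k \<and> t = 1)" for t
  proof -
    have "(a1 - b1)\<^sup>2 = (a1 - c1)\<^sup>2" using eq opp by simp
    moreover have "b1 \<noteq> c1" using abc(2) opp unfolding b c by auto
    ultimately have c1: "c1 = 2 * a1 - b1" by (auto simp: power2_eq_iff)
    define d where "d = \<bar>a1 - b1\<bar>"
    have d: "d > 0" using c1 \<open>b1 \<noteq> c1\<close> by (auto simp: d_def)
    have "T = fan (of_int a2) (of_int t) (of_int a1, of_int d)"
      unfolding abc(1) a b c fan_def d_def using opp c1 by (auto simp: abs_if)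
    moreover have "of_int d > (0::real)" using d by simp
    moreover have "{a1 - d, a1, a1 + d} \<subseteq> {1..int n}"
      using range c1 by (auto simp: d_def abs_if)
    then have "{of_int a1 - of_int d, of_int a1, of_int a1 + of_int d} \<subseteq> real ` {1..n}"
      using in_rows[of "a1 - d"] in_rows[of a1] in_rows[of "a1 + d"] by auto
    ultimately show ?thesis
      using st unfolding fans_def Let_def by auto
  qed
  have tent_case: "T \<in> tents n k" if mid: "2 * a2 = int k + 1" and y: "b1 = c1"
    and st: "(b2 = 1 \<and> c2 = int k) \<or> (b2 = int k \<and> c2 = 1)"
  proof -
    have "odd k" using mid by presburger
    have "real_of_int (2 * a2) = real_of_int (int k + 1)" using mid by (simp only:)
    then have "real_of_int a2 = (real k + 1) / 2" by simp
    then have "T = tent k (of_int b1, of_int a1)"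
      unfolding abc(1) a b c tent_def using y st by auto
    moreover have "b1 \<noteq> a1"
      using ncol y unfolding a b c by (auto simp: collinear_cross_product)
    ultimately show ?thesis
      unfolding tents_def using \<open>odd k\<close> range in_rows[of a1] in_rows[of b1] by auto
  qed
  \<comment> \<open>The triangle meets both end columns: an apex in one of them forces \<open>b\<close> or \<open>c\<close> into the other,
    and an apex in neither leaves one end column to each of \<open>b\<close> and \<open>c\<close>.\<close>
  consider (left) "a2 = 1" | (right) "a2 = int k" | (middle) "a2 \<noteq> 1" "a2 \<noteq> int k" by blast
  then show ?thesis
  proof cases
    case left
    have "b2 = int k \<and> c2 = int k"
    proof (cases "b2 = int k")
      case True
      have "c2 - 1 = w"
        by (rule column_of_long_side[of _ _ "a1 - c1" m "a1 - b1"])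
          (use eq True left range mw w2 row_bound in \<open>auto simp: w_def power2_commute\<close>)
      then show ?thesis using True by (simp add: w_def)
    next
      case False
      then have "c2 = int k" using ends' left w2 by (auto simp: w_def)
      moreover have "b2 - 1 = w"
        by (rule column_of_long_side[of _ _ "a1 - b1" m "a1 - c1"])
          (use eq \<open>c2 = int k\<close> left range mw w2 row_bound in \<open>auto simp: w_def power2_commute\<close>)
      ultimately show ?thesis by (simp add: w_def)
    qed
    then show ?thesis using fan_case[of "int k"] left by auto
  next
    case right
    have "b2 = 1 \<and> c2 = 1"
    proof (cases "b2 = 1")
      case True
      have "int k - c2 = w"
        by (rule column_of_long_side[of _ _ "a1 - c1" m "a1 - b1"])
          (use eq True right range mw w2 row_bound in \<open>auto simp: w_def power2_commute\<close>)
      then show ?thesis using True by (simp add: w_def)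
    next
      case False
      then have "c2 = 1" using ends' right w2 by (auto simp: w_def)
      moreover have "int k - b2 = w"
        by (rule column_of_long_side[of _ _ "a1 - b1" m "a1 - c1"])
          (use eq \<open>c2 = 1\<close> right range mw w2 row_bound in \<open>auto simp: w_def power2_commute\<close>)
      ultimately show ?thesis by (simp add: w_def)
    qed
    then show ?thesis using fan_case[of 1] right by auto
  next
    case middle
    then have st: "(b2 = 1 \<and> c2 = int k) \<or> (b2 = int k \<and> c2 = 1)"
      using ends' w2 by (auto simp: w_def)
    have mid: "2 * (a2 - 1) = w"
    proof (cases "b2 = 1")
      case True
      show ?thesis
        by (rule column_of_middle_apex[of "a1 - b1" m "a1 - c1"])
          (use eq True st w2 mw row_bound \<open>even m\<close> in \<open>auto simp: w_def power2_commute\<close>)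
    next
      case False
      show ?thesis
        by (rule column_of_middle_apex[of "a1 - c1" m "a1 - b1"])
          (use eq False st w2 mw row_bound \<open>even m\<close> in \<open>auto simp: w_def power2_commute\<close>)
    qed
    have mid': "2 * a2 = int k + 1" using mid by (simp add: w_def)
    then have e2: "a2 - b2 = c2 - a2" using st by auto
    have "(a2 - b2)\<^sup>2 = (a2 - c2)\<^sup>2" unfolding e2 by (rule power2_commute)
    then have "(a1 - b1)\<^sup>2 = (a1 - c1)\<^sup>2" using eq by simp
    then have "b1 = c1 \<or> 2 * a1 = b1 + c1" by (auto simp: power2_eq_iff)
    moreover have "2 * a1 \<noteq> b1 + c1"
    proof
      assume "2 * a1 = b1 + c1"
      then have e1: "a1 - b1 = c1 - a1" by simp
      have "real_of_int (a1 - b1) = real_of_int (c1 - a1)"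
        "real_of_int (a2 - b2) = real_of_int (c2 - a2)" using e1 e2 by (simp_all only:)
      then have c': "real_of_int c1 = 2 * a1 - b1" "real_of_int c2 = 2 * a2 - b2" by simp_all
      have "collinear {a, b, c}"
        unfolding a b c c' by (simp add: collinear_cross_product algebra_simps)
      with ncol show False by simp
    qed
    ultimately show ?thesis using tent_case mid' st by auto
  qed
qed

section \<open>Counting spanning triangles\<close>

text \<open>
  Odd \<open>n \<ge> 2\<close> means \<open>n - 1 \<ge> 2\<close>, so \<open>k - 1 \<ge> (n - 1)\<^sup>2 \<ge> 2 (n - 1)\<close>, and tents are not acute. They
  are obtuse if the inequality between the outer terms is strict, which the bound \<open>k > 5\<close>
  ensures in the one exceptional case \<open>n = 3\<close>.
\<close>

lemma
  assumes n: "odd n" "n \<ge> 2" and k: "k - 1 \<ge> (n - 1)\<^sup>2"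
  shows spanning_acute:
      "spanning_sets (\<lambda>T. is_triangle T \<and> isosceles T \<and> acute T) n k = fans n k"
    and spanning_obtuse: "k > 5 \<Longrightarrow>
      spanning_sets (\<lambda>T. is_triangle T \<and> isosceles T \<and> obtuse T) n k = tents n k"
    and spanning_right: "k > 5 \<Longrightarrow>
      spanning_sets (\<lambda>T. is_triangle T \<and> isosceles T \<and> right_angled T) n k = {}"
proof -
  have n3: "n \<ge> 3" using n by presburger
  have "2 * (n - 1) \<le> (n - 1)\<^sup>2" using n3 by (simp add: power2_eq_square)
  then have wide: "2 * (n - 1) \<le> k - 1" using k by linarith
  then have kn: "k > n" "k > 1" using n3 by auto
  have wide': "2 * (n - 1) < k - 1" if "k > 5"
  proof (cases "n = 3")
    case True
    then show ?thesis using that by simp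
  next
    case False
    then have "n - 1 > 2" using n3 by simp
    then have "2 * (n - 1) < (n - 1) * (n - 1)" by simp
    then show ?thesis using k unfolding power2_eq_square by linarith
  qed
  have refine: "spanning_sets (\<lambda>T. is_triangle T \<and> isosceles T \<and> P T) n k
      = {T \<in> fans n k \<union> tents n k. P T}" for P
  proof -
    have "spanning_sets (\<lambda>T. is_triangle T \<and> isosceles T) n k = fans n k \<union> tents n k"
      using spanning_isosceles_cases[OF n k] fans_acute[OF kn(1)] tents_spanning[OF kn(2)]
      unfolding spanning_sets_def grid_sets_def by blast
    then show ?thesis unfolding spanning_sets_def grid_sets_def by blast
  qed
  have fans: "acute T" if "T \<in> fans n k" for T
    using fans_acute[OF kn(1) that] by (simp add: spanning_sets_def grid_sets_def)
  show "spanning_sets (\<lambda>T. is_triangle T \<and> isosceles T \<and> acute T) n k = fans n k"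
    unfolding refine using fans tents_not_acute[OF kn(2) _ wide] by blast
  show "spanning_sets (\<lambda>T. is_triangle T \<and> isosceles T \<and> obtuse T) n k = tents n k" if "k > 5"
    unfolding refine
    using acute_not_obtuse_right[OF fans] tents_obtuse[OF kn(2) _ wide'[OF that]] by blast
  show "spanning_sets (\<lambda>T. is_triangle T \<and> isosceles T \<and> right_angled T) n k = {}" if "k > 5"
    unfolding refine
    using acute_not_obtuse_right[OF fans] tents_obtuse[OF kn(2) _ wide'[OF that]] by blast
qed

text \<open>
  The affine map \<open>\<phi>\<close> of the columns that fixes 1 and sends \<open>k\<close> to \<open>k + 2\<close> also sends midpoint to
  midpoint, and it leaves the rows alone. It thus carries fans to fans and tents to tents, although it
  does not preserve lengths or the grid. The step is 2 because tents need an odd \<open>k\<close>.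
\<close>

lemma
  assumes k: "k > 1"
  shows card_fans_periodic: "card (fans n (k + 2)) = card (fans n k)"
    and card_tents_periodic: "card (tents n (k + 2)) = card (tents n k)"
proof -
  define r where "r = (real k + 1) / (real k - 1)"
  define \<phi> :: "real \<times> real \<Rightarrow> real \<times> real" where "\<phi> = (\<lambda>(y, t). (y, 1 + (t - 1) * r))"
  have r: "r > 0" "(real k - 1) * r = real k + 1" using k by (simp_all add: r_def)
  have "inj \<phi>" using r by (auto simp: \<phi>_def inj_def)
  then have inj: "inj_on (image \<phi>) X" for X by (intro inj_onI) (simp add: inj_image_eq_iff)
  have \<phi>: "\<phi> (y, 1) = (y, 1)" "\<phi> (y, real k) = (y, real (k + 2))"
    "\<phi> (y, (real k + 1) / 2) = (y, (real (k + 2) + 1) / 2)" for y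
  proof -
    have "((real k + 1) / 2 - 1) * r = (real k - 1) * r / 2" by (simp add: field_simps)
    then show "\<phi> (y, (real k + 1) / 2) = (y, (real (k + 2) + 1) / 2)"
      unfolding \<phi>_def using r by (simp add: field_simps)
  qed (use r in \<open>simp_all add: \<phi>_def\<close>)
  have "image \<phi> ` fans n k = fans n (k + 2)"
    unfolding fans_def Let_def image_Un image_image fan_def
    by (simp only: case_prod_unfold image_insert image_empty \<phi>)
  then show "card (fans n (k + 2)) = card (fans n k)" by (metis card_image inj)
  have "image \<phi> ` tents n k = tents n (k + 2)"
  proof (cases "odd k")
    case True
    then have "odd (k + 2)" by simp
    show ?thesis
      unfolding tents_def if_P[OF True] if_P[OF \<open>odd (k + 2)\<close>] image_image tent_def
      by (simp only: case_prod_unfold image_insert image_empty \<phi>)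
  qed (simp add: tents_def)
  then show "card (tents n (k + 2)) = card (tents n k)" by (metis card_image inj)
qed

section \<open>The recurrences\<close>

theorem theorem8:
  fixes n :: nat
  assumes "n \<ge> 2" and "odd n"
  shows "(\<forall>k::nat. k > (n - 1)\<^sup>2 + 2 \<longrightarrow>
            num_acute n k =
              2 * num_acute n (k - 1) - 2 * num_acute n (k - 3) + num_acute n (k - 4)) \<and>
         (\<forall>k::nat. k > max 7 ((n - 1)\<^sup>2 + 2) \<longrightarrow>
            num_obtuse n k =
              2 * num_obtuse n (k - 1) - 2 * num_obtuse n (k - 3) + num_obtuse n (k - 4) \<and>
            num_right n k =
              2 * num_right n (k - 1) - 2 * num_right n (k - 3) + num_right n (k - 4))"
proof -
  let ?Q = "\<lambda>P T. is_triangle T \<and> isosceles T \<and> P T"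
  have counts: "num_acute n k = int (card (grid_sets (?Q acute) n k))"
    "num_obtuse n k = int (card (grid_sets (?Q obtuse) n k))"
    "num_right n k = int (card (grid_sets (?Q right_angled) n k))" for k
    unfolding num_acute_def num_obtuse_def num_right_def isosceles_triangles_def grid_sets_def
    by (simp_all add: conj_assoc)
  have inv: "?Q acute ((+) v ` T) \<longleftrightarrow> ?Q acute T"
    "?Q obtuse ((+) v ` T) \<longleftrightarrow> ?Q obtuse T"
    "?Q right_angled ((+) v ` T) \<longleftrightarrow> ?Q right_angled T" for v T
    by (simp_all add: translate_iff acute_def obtuse_def right_angled_def)
  have "n - 1 \<ge> 2" using assms by presburger
  then have "2\<^sup>2 \<le> (n - 1)\<^sup>2" by (intro power_mono) auto
  then have sq: "(n - 1)\<^sup>2 \<ge> 4" by simp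
  show ?thesis
  proof (intro conjI allI impI)
    fix k assume k: "k > (n - 1)\<^sup>2 + 2"
    then have b: "k - 1 \<ge> (n - 1)\<^sup>2" "k - 2 - 1 \<ge> (n - 1)\<^sup>2" "k - 2 > 1" "k - 2 + 2 = k" "k \<ge> 4"
      using sq by linarith+
    have "card (spanning_sets (?Q acute) n k) = card (spanning_sets (?Q acute) n (k - 2))"
      using card_fans_periodic[OF b(3), of n]
      by (simp only: spanning_acute[OF assms(2,1) b(1)] spanning_acute[OF assms(2,1) b(2)] b(4))
    then show "num_acute n k =
        2 * num_acute n (k - 1) - 2 * num_acute n (k - 3) + num_acute n (k - 4)"
      unfolding counts by (intro card_grid_sets_recurrence inv b(5))
  next
    fix k assume k: "k > max 7 ((n - 1)\<^sup>2 + 2)"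
    then have b: "k - 1 \<ge> (n - 1)\<^sup>2" "k - 2 - 1 \<ge> (n - 1)\<^sup>2" "k - 2 > 1" "k - 2 + 2 = k" "k \<ge> 4"
      "k > 5" "k - 2 > 5"
      using sq by linarith+
    have "card (spanning_sets (?Q obtuse) n k) = card (spanning_sets (?Q obtuse) n (k - 2))"
      using card_tents_periodic[OF b(3), of n]
      by (simp only: spanning_obtuse[OF assms(2,1) b(1,6)] spanning_obtuse[OF assms(2,1) b(2,7)] b(4))
    then show "num_obtuse n k =
        2 * num_obtuse n (k - 1) - 2 * num_obtuse n (k - 3) + num_obtuse n (k - 4)"
      unfolding counts by (intro card_grid_sets_recurrence inv b(5))
    have "card (spanning_sets (?Q right_angled) n k) = card (spanning_sets (?Q right_angled) n (k - 2))"
      by (simp only: spanning_right[OF assms(2,1) b(1,6)] spanning_right[OF assms(2,1) b(2,7)])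
    then show "num_right n k =
        2 * num_right n (k - 1) - 2 * num_right n (k - 3) + num_right n (k - 4)"
      unfolding counts by (intro card_grid_sets_recurrence inv b(5))
  qed
qed

end
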